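(* Let $m\ge3$ and let $T_m$ be the graph defined below. Then $1$ is a simple eigenvalue of $T_m$ if and only if $4\nmid m$ and $5\nmid m$.
   Context: For $m\ge3$, $T_m$ is the cubic graph on $2m^2$ vertices $\{x^+_{i,j},\,x^-_{i,j}\mid i,j\in\mathbb{Z}_m\}$ with edges $\{x^+_{i,j},x^+_{i,j+1}\}$, $\{x^-_{i,j},x^-_{i,j+1}\}$ and $\{x^+_{i,j},x^-_{j,i}\}$ for all $i,j\in\mathbb{Z}_m$. Eigenvalues are those of the adjacency matrix; simple means a $1$-dimensional eigenspace. *)

theory Defs
  imports "Jordan_Normal_Form.Jordan_Normal_Form_Uniqueness"
begin

(* Vertices of T_m: triples (s, i, j) with s = True for x^+_{i,j}, s = False for x^-_{i,j},
   and i, j in {0..<m} representing Z_m. *)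
definition T_adj :: "nat \<Rightarrow> bool \<times> nat \<times> nat \<Rightarrow> bool \<times> nat \<times> nat \<Rightarrow> bool" where
  "T_adj m u v = (case u of (s, i, j) \<Rightarrow> case v of (t, k, l) \<Rightarrow>
      (s = t \<and> i = k \<and> (l = (j + 1) mod m \<or> j = (l + 1) mod m))
    \<or> (s \<noteq> t \<and> k = j \<and> l = i))"

definition T_vertex :: "nat \<Rightarrow> nat \<Rightarrow> bool \<times> nat \<times> nat" where
  "T_vertex m n = (n < m^2, (n mod m^2) div m, n mod m)"

definition T_adj_matrix :: "nat \<Rightarrow> real mat" where
  "T_adj_matrix m = mat (2 * m^2) (2 * m^2)
     (\<lambda>(a, b). if T_adj m (T_vertex m a) (T_vertex m b) then 1 else 0)"

definition simple_eigenvalue :: "real mat \<Rightarrow> real \<Rightarrow> bool" where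
  "simple_eigenvalue A ev \<longleftrightarrow> kernel_dim (char_matrix A ev) = 1"

end

(* An eigenfunction F for the eigenvalue 1 is determined by a(i,j) = F(x^+_{i,j}), with
   c(i,j) = F(x^-_{j,i}) = a(i,j) - a(i,j+1) - a(i,j-1) and a(i,j) = c(i,j) - c(i+1,j) - c(i-1,j).
   Taking Fourier transforms on Z_m^2, the dimension of the eigenspace is the number of pairs (u, v)
   of m-th roots of unity with (2 Re u - 1) (2 Re v - 1) = 1. The pair (1, 1) always counts;
   4 | m gives (i, i), and 5 | m gives (e(1/5), e(2/5)), where e(t) = exp (2 pi i t).

   Conversely, the equation is polynomial in a primitive m-th root of unity, so it survives
   every Galois conjugation u -> u^k, v -> v^k with k coprime to m. For real numbers x, y in [-1, 1]
   with (2x - 1) (2y - 1) = 1 one has x = 1 or x <= 1/3. If u has order n > 1, some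
   conjugate of it is e(1/n), hence cos (2 pi / n) <= 1/3 and n <= 5. If neither 4 nor 5 divides m,
   then n is 2 or 3, so Re u < 0; likewise Re v < 0, and then the product exceeds 1. *)
theory Submission
  imports Defs "HOL-Number_Theory.Residues"
begin

section \<open>Galois conjugation of roots of unity\<close>

hide_const (open) Module.smult UnivPoly.monom up_ring.monom UnivPoly.coeff up_ring.coeff

section \<open>Evaluation of integer polynomials, and the Frobenius congruence modulo a
  prime\<close>

abbreviation ipoly :: "int poly \<Rightarrow> complex \<Rightarrow> complex" where
  "ipoly P z \<equiv> poly (map_poly of_int P) z"

lemma ipoly_add [simp]: "ipoly (P + Q) z = ipoly P z + ipoly Q z"
  by (simp add: of_int_poly_hom.hom_add)

lemma ipoly_diff [simp]: "ipoly (P - Q) z = ipoly P z - ipoly Q z"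
  by (simp add: of_int_poly_hom.hom_minus)

lemma ipoly_mult [simp]: "ipoly (P * Q) z = ipoly P z * ipoly Q z"
  by (simp add: of_int_poly_hom.hom_mult)

lemma ipoly_smult [simp]: "ipoly (smult c P) z = of_int c * ipoly P z"
  by (simp add: of_int_hom.map_poly_hom_smult)

lemma ipoly_power [simp]: "ipoly (P ^ n) z = ipoly P z ^ n"
  by (simp add: of_int_poly_hom.hom_power)

lemma ipoly_pcompose [simp]: "ipoly (pcompose P Q) z = ipoly P (ipoly Q z)"
  by (induction P) (simp_all add: pcompose_pCons of_int_hom.map_poly_pCons_hom)

lemma prime_dvd_binomial_power_diff:
  fixes u v :: "'a :: comm_ring_1"
  assumes "prime p"
  shows "of_nat p dvd (u + v) ^ p - (u ^ p + v ^ p)"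
proof -
  have p: "p > 0" "p \<noteq> 0" using assms prime_gt_0_nat by auto
  have "(u + v) ^ p = (\<Sum>k\<le>p. of_nat (p choose k) * u ^ k * v ^ (p - k))"
    by (rule binomial_ring)
  also have "{..p} = insert 0 (insert p {1..<p})" using p by auto
  also have "(\<Sum>k\<in>\<dots>. of_nat (p choose k) * u ^ k * v ^ (p - k))
      = v ^ p + u ^ p + (\<Sum>k\<in>{1..<p}. of_nat (p choose k) * u ^ k * v ^ (p - k))"
    using p by simp
  finally have eq: "(u + v) ^ p - (u ^ p + v ^ p) =
      (\<Sum>k\<in>{1..<p}. of_nat (p choose k) * u ^ k * v ^ (p - k))"
    by (simp add: algebra_simps)
  have "of_nat p dvd (of_nat (p choose k) * u ^ k * v ^ (p - k))" if "k \<in> {1..<p}" for k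
  proof -
    have "p dvd (p choose k)" using that assms p by (intro dvd_choose_prime) auto
    then obtain c where "p choose k = p * c" by blast
    then show ?thesis by (simp add: mult.assoc)
  qed
  then show ?thesis unfolding eq by (intro dvd_sum)
qed

lemma prime_dvd_power_minus_int:
  fixes a :: int
  assumes "prime p"
  shows "int p dvd a ^ p - a"
proof -
  have p: "p > 0" using assms prime_gt_0_nat by auto
  have nat: "int p dvd int n ^ p - int n" for n
  proof (induction n)
    case (Suc n)
    have "int p dvd ((int n + 1) ^ p - (int n ^ p + 1 ^ p)) + (int n ^ p - int n)"
      using prime_dvd_binomial_power_diff[OF assms, of "int n" 1] Suc by (intro dvd_add) auto
    then show ?case by (simp add: algebra_simps)
  qed (use p in \<open>simp add: zero_power\<close>)
  \<comment> \<open>The induction covers nonnegative integers only; a nonnegative representative of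
    the residue class of \<open>a\<close> handles the rest.\<close>
  obtain n :: nat where n: "[a = int n] (mod int p)"
    using p by (metis cong_int_iff cong_mod_right cong_refl pos_mod_sign nonneg_int_cases of_nat_0_less_iff)
  then have "[a ^ p - a = int n ^ p - int n] (mod int p)"
    by (intro cong_diff cong_pow)
  with nat show ?thesis using cong_dvd_iff by blast
qed

text \<open>Frobenius: f(x^p) and f(x)^p agree modulo p. Writing f = a + x Q, the constant a is
  handled by Fermat's little theorem, x Q by induction, and the mixed terms of the p-th power by the
  binomial coefficients.\<close>

lemma prime_dvd_pcompose_monom_minus_power:
  fixes P :: "int poly"
  assumes "prime p"
  shows "of_nat p dvd pcompose P (monom 1 p) - P ^ p"
proof (induction P)
  case 0
  then show ?case using assms prime_gt_0_nat[of p] by (simp add: zero_power)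
next
  case (pCons a Q)
  let ?x = "monom (1::int) 1"
  have split: "pCons a Q = [:a:] + ?x * Q" by (simp add: monom_Suc)
  obtain c where c: "a ^ p - a = int p * c" using prime_dvd_power_minus_int[OF assms, of a] by blast
  have "[:a:] - [:a:] ^ p = of_nat p * [:-c:]"
    using c by (simp add: poly_const_pow of_nat_poly algebra_simps)
  then have 1: "of_nat p dvd [:a:] - [:a:] ^ p" by (metis dvd_triv_left)
  have 2: "of_nat p dvd monom 1 p * (pcompose Q (monom 1 p) - Q ^ p)"
    using pCons.IH by (rule dvd_mult)
  have 3: "of_nat p dvd ([:a:] + ?x * Q) ^ p - ([:a:] ^ p + (?x * Q) ^ p)"
    by (rule prime_dvd_binomial_power_diff[OF assms])
  have xp: "(?x * Q) ^ p = monom 1 p * Q ^ p"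
    by (simp add: power_mult_distrib monom_power)
  have "pcompose (pCons a Q) (monom 1 p) - pCons a Q ^ p =
     ([:a:] - [:a:] ^ p) + monom 1 p * (pcompose Q (monom 1 p) - Q ^ p)
     - (([:a:] + ?x * Q) ^ p - ([:a:] ^ p + (?x * Q) ^ p))"
    unfolding xp unfolding split[symmetric] by (simp add: pcompose_pCons algebra_simps)
  then show ?case using 1 2 3 by (metis dvd_add dvd_diff)
qed

section \<open>Monic minimal polynomials over the integers\<close>

lemma monic_division:
  fixes f P :: "int poly"
  assumes "lead_coeff f = 1"
  obtains q r where "P = f * q + r" "r = 0 \<or> degree r < degree f"
proof -
  have f0: "f \<noteq> 0" using assms by auto
  obtain q r where qr: "pseudo_divmod P f = (q, r)" by (cases "pseudo_divmod P f")
  from pseudo_divmod[OF f0 qr] that show thesis using assms by auto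
qed

text \<open>An algebraic integer has a monic minimal polynomial in Z[x]. Take the primitive part of
  a nonzero integer polynomial of least degree vanishing at z. By Gauss's lemma it divides the monic
  \<open>g\<close>, so its leading coefficient is 1 or -1. Being monic, it permits division with
  remainder without leaving Z[x].\<close>

lemma monic_minimal_int_poly:
  fixes z :: complex
  assumes g: "lead_coeff g = 1" "ipoly g z = 0"
  obtains f where "lead_coeff f = 1" "ipoly f z = 0"
    "\<And>r. ipoly r z = 0 \<Longrightarrow> degree r < degree f \<Longrightarrow> r = 0"
proof -
  have g0: "g \<noteq> 0" using g by auto
  define S where "S = (\<lambda>h. h \<noteq> 0 \<and> ipoly h z = 0)"
  have "S g" using g0 g by (simp add: S_def)
  define h where "h = arg_min degree S"
  have h: "S h" and h_min: "\<And>r. S r \<Longrightarrow> degree h \<le> degree r"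
    unfolding h_def using \<open>S g\<close> by (auto intro: arg_min_natI arg_min_nat_le)
  define h' where "h' = primitive_part h"
  have h'0: "h' \<noteq> 0" using h by (simp add: h'_def S_def)
  have deg: "degree h' = degree h" by (simp add: h'_def)
  have "h = smult (content h) h'" by (simp add: h'_def)
  then have "ipoly h z = of_int (content h) * ipoly h' z" by (metis ipoly_smult)
  then have h'z: "ipoly h' z = 0" using h by (auto simp: S_def)
  have min: "r = 0" if "ipoly r z = 0" "degree r < degree h'" for r
    using that h_min[of r] deg by (auto simp: S_def)
  \<comment> \<open>Since \<open>h'\<close> is not yet known to be monic, only a multiple of
    \<open>g\<close> can be divided by it. The remainder vanishes at z and is zero by
    minimality.\<close>
  obtain a q where aq: "a \<noteq> 0" "smult a g = h' * q + pseudo_mod g h'"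
    using pseudo_mod(1)[OF h'0] by blast
  have "ipoly (pseudo_mod g h') z = ipoly (smult a g - h' * q) z" by (simp add: aq)
  also have "\<dots> = 0" using g h'z by simp
  finally have "pseudo_mod g h' = 0" using pseudo_mod(2)[OF h'0, of g] min by blast
  with aq have agq: "smult a g = h' * q" by simp
  have "content g dvd lead_coeff g" by (rule content_dvd_coeff)
  then have cg: "content g = 1" using g by (metis content_dvd_coeff is_unit_content_iff)
  have ch: "content h' = 1" using h by (simp add: h'_def S_def)
  have "content (smult a g) = content (h' * q)" by (simp add: agq)
  \<comment> \<open>Gauss's lemma: \<open>g\<close> and \<open>h'\<close> are primitive, so
    \<open>q\<close> absorbs the whole factor \<open>a\<close>, which can then be cancelled.\<close>
  then have "content q = normalize a" by (simp add: content_mult cg ch)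
  then have "a dvd content q" by simp
  then have "[:a:] dvd q" by (simp add: const_poly_dvd_iff_dvd_content)
  then obtain q' where "q = smult a q'" by (auto elim!: dvdE)
  then have "smult a g = smult a (h' * q')" using agq by simp
  then have "g = h' * q'" using aq(1) by (metis smult_cancel)
  then have "lead_coeff h' * lead_coeff q' = 1" using g by (metis lead_coeff_mult)
  then consider "lead_coeff h' = 1" | "lead_coeff h' = -1" using zmult_eq_1_iff by blast
  then show thesis
  proof cases
    case 1
    with that[of h'] h'z min show ?thesis by blast
  next
    case 2
    have "ipoly (- h') z = 0" using h'z ipoly_smult[of "-1" h' z] by simp
    with 2 that[of "- h'"] min show ?thesis by auto
  qed
qed

text \<open>Dedekind's argument for the irreducibility of cyclotomic polynomials. Every integer
  polynomial vanishing at z is a multiple of the minimal polynomial \<open>f\<close>, so it suffices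
  that \<open>f\<close> itself vanishes at z^p.\<close>

lemma root_of_unity_conjugate_prime:
  fixes z :: complex
  assumes zm: "z ^ m = 1" and m: "m > 0" and p: "prime p" "\<not> p dvd m"
    and P: "ipoly P z = 0"
  shows "ipoly P (z ^ p) = 0"
proof -
  define c where "c = monom 1 m - (1 :: int poly)"
  have lc: "lead_coeff c = 1"
  proof -
    have "degree c = m" unfolding c_def using m
      by (subst diff_conv_add_uminus, subst degree_add_eq_left) (auto simp: degree_monom_eq)
    then show ?thesis using m by (simp add: c_def coeff_1)
  qed
  have c_eval: "ipoly c w = w ^ m - 1" for w
    by (simp add: c_def poly_monom)
  obtain f where f: "lead_coeff f = 1" "ipoly f z = 0"
    and fmin: "\<And>r. ipoly r z = 0 \<Longrightarrow> degree r < degree f \<Longrightarrow> r = 0"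
    using monic_minimal_int_poly[OF lc] c_eval[of z] zm by auto
  have f_dvd: "f dvd h" if h: "ipoly h z = 0" for h
  proof -
    obtain q r where qr: "h = f * q + r" "r = 0 \<or> degree r < degree f"
      using monic_division[OF f(1)] .
    have "ipoly r z = ipoly (h - f * q) z" using qr by simp
    also have "\<dots> = 0" using h f by simp
    finally have "r = 0" using fmin qr by blast
    then show ?thesis using qr by simp
  qed
  (* Otherwise z^p is a root of the cofactor g. Differentiating x^m - 1 = f g at z^p and using
     f(x^p) = f(x)^p mod p gives m = p H(z) with H an integer polynomial; reducing H modulo f
     yields p | m. *)
  have "ipoly f (z ^ p) = 0"
  proof (rule ccontr)
    assume nz: "ipoly f (z ^ p) \<noteq> 0"
    obtain g where g: "c = f * g" using f_dvd[of c] c_eval[of z] zm by (auto elim: dvdE)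
    define w where "w = z ^ p"
    have wm: "w ^ m = 1" unfolding w_def by (metis power_mult mult.commute zm power_one)
    have "ipoly f w * ipoly g w = 0" using c_eval[of w] wm g by simp
    then have gw: "ipoly g w = 0" using nz by (simp add: w_def)
    have "pderiv c = pderiv f * g + f * pderiv g" by (simp add: g pderiv_mult algebra_simps)
    then have "ipoly (pderiv c) w = ipoly f w * ipoly (pderiv g) w"
      using gw by (simp)
    moreover have "ipoly (pderiv c) w = of_nat m * w ^ (m - 1)"
      by (simp add: c_def pderiv_diff pderiv_monom poly_monom)
    ultimately have "of_nat m * (w ^ (m - 1) * w) = w * ipoly f w * ipoly (pderiv g) w"
      by simp
    moreover have "w ^ (m - 1) * w = 1" using wm m by (metis power_minus_mult)
    ultimately have mw: "of_nat m = w * ipoly f w * ipoly (pderiv g) w" by (metis mult.right_neutral)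
    obtain h where h: "pcompose f (monom 1 p) - f ^ p = of_nat p * h"
      using prime_dvd_pcompose_monom_minus_power[OF p(1), of f] by blast
    have "ipoly (pcompose f (monom 1 p) - f ^ p) z = ipoly f w"
      using f prime_gt_0_nat[OF p(1)] by (simp add: w_def poly_monom zero_power)
    moreover have "ipoly (of_nat p * h) z = of_nat p * ipoly h z"
      by (simp add: of_nat_poly)
    ultimately have fw: "ipoly f w = of_nat p * ipoly h z" using h by metis
    define H where "H = monom 1 p * h * pcompose (pderiv g) (monom 1 p)"
    have Hz: "of_nat m = of_nat p * ipoly H z"
      unfolding mw fw H_def by (simp add: w_def poly_monom)
    obtain q r where qr: "H = f * q + r" "r = 0 \<or> degree r < degree f"
      using monic_division[OF f(1)] .
    \<comment> \<open>Needed for the constant \<open>m\<close> to have smaller degree than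
      \<open>f\<close>, so that minimality applies to \<open>p r - m\<close>.\<close>
    have fpos: "degree f > 0"
      using f monic_degree_0[of f] by (auto intro!: Nat.gr0I)
    have "ipoly H z = ipoly r z" using qr f by simp
    then have "ipoly (smult (int p) r - [:int m:]) z = 0"
      using Hz by (simp add: of_int_hom.map_poly_pCons_hom)
    moreover have "degree (smult (int p) r - [:int m:]) < degree f"
      using qr fpos by (intro degree_diff_less) auto
    ultimately have "smult (int p) r = [:int m:]" using fmin by fastforce
    then have "int p * coeff r 0 = int m" by (metis coeff_smult coeff_pCons_0)
    then have "int p dvd int m" by (metis dvd_triv_left)
    with p show False by simp
  qed
  moreover obtain q where "P = f * q" using f_dvd[OF P] by blast
  ultimately show ?thesis by simp
qed

text \<open>Prime factors of k are peeled off one at a time. The induction generalizes z because the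
  hypothesis is applied to z^p, again an m-th root of unity.\<close>

lemma root_of_unity_conjugate:
  fixes z :: complex
  assumes "z ^ m = 1" "m > 0" "coprime k m" "k > 0" "ipoly P z = 0"
  shows "ipoly P (z ^ k) = 0"
  using assms
proof (induction k arbitrary: z rule: nat_less_induct)
  case (1 k)
  show ?case
  proof (cases "k = 1")
    case False
    then obtain p where p: "prime p" "p dvd k" using prime_factor_nat by blast
    then obtain l where l: "k = p * l" by blast
    have "\<not> p dvd m" using 1 p by (meson coprime_common_divisor not_prime_unit)
    then have "ipoly P (z ^ p) = 0" using root_of_unity_conjugate_prime 1 p by blast
    moreover have "(z ^ p) ^ m = 1" using 1 by (metis power_mult mult.commute power_one)
    moreover have "l < k" "l > 0" "coprime l m"
      using l 1 p prime_gt_1_nat[of p] by (auto simp: coprime_mult_left_iff)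
    ultimately show ?thesis using 1 l by (metis power_mult)
  qed (use 1 in simp)
qed

section \<open>The equation for pairs of roots of unity\<close>

text \<open>On the unit circle 2 Re u = u + 1/u. This turns conditions on real parts into polynomial
  ones, to which conjugation applies.\<close>

lemma unit_complex_quadratic:
  fixes u :: complex
  assumes "norm u = 1"
  shows "u ^ 2 - u + 1 = u * of_real (2 * Re u - 1)"
proof -
  have "u * cnj u = 1" using assms by (simp add: complex_norm_square[symmetric])
  moreover have "complex_of_real (2 * Re u) = u + cnj u" by (simp add: complex_add_cnj)
  ultimately show ?thesis by (simp add: power2_eq_square algebra_simps)
qed

lemma roots_of_unity_norm_1:
  fixes u :: complex
  assumes "u ^ m = 1" "m > 0"
  shows "norm u = 1"
proof -
  have "norm u ^ m = 1" using assms by (metis norm_one norm_power)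
  then show ?thesis using power_eq_imp_eq_base[of "norm u" m 1] assms(2) by simp
qed

lemma root_of_unity_cis:
  fixes u :: complex
  assumes "u ^ m = 1" "m > 0"
  obtains a where "a < m" "u = cis (2 * pi / m) ^ a"
proof -
  have "u \<in> {z. z ^ m = 1}" using assms by simp
  then have "u \<in> (\<lambda>k. cis (2 * pi * real k / real m)) ` {..<m}"
    using bij_betw_roots_unity[OF assms(2)] by (auto simp: bij_betw_def)
  then show thesis using that by (auto simp: DeMoivre mult_ac)
qed

lemma conjugate_Re_equation:
  fixes u v :: complex
  assumes uv: "u ^ m = 1" "v ^ m = 1" and m: "m > 0" and k: "coprime k m" "k > 0"
    and eq: "(2 * Re u - 1) * (2 * Re v - 1) = 1"
  shows "(2 * Re (u ^ k) - 1) * (2 * Re (v ^ k) - 1) = 1"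
proof -
  define z where "z = cis (2 * pi / m)"
  have zm: "z ^ m = 1" using m by (simp add: z_def DeMoivre)
  obtain a b where ab: "u = z ^ a" "v = z ^ b"
    using root_of_unity_cis[OF uv(1) m] root_of_unity_cis[OF uv(2) m] unfolding z_def by metis
  \<comment> \<open>The equation multiplied by u v, with u = x^a and v = x^b: on the unit circle
    \<open>P\<close> equals u v ((2 Re u - 1) (2 Re v - 1) - 1).\<close>
  define P :: "int poly" where "P = (monom 1 a ^ 2 - monom 1 a + 1) * (monom 1 b ^ 2 - monom 1 b + 1)
     - monom 1 a * monom 1 b"
  have P_eval: "ipoly P w = ((w^a)^2 - w^a + 1) * ((w^b)^2 - w^b + 1) - w^a * w^b" for w
    by (simp add: P_def poly_monom power_mult)
  have P_iff: "ipoly P w = 0 \<longleftrightarrow> (2 * Re (w^a) - 1) * (2 * Re (w^b) - 1) = 1" if "norm w = 1" for w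
  proof -
    have n: "norm (w^a) = 1" "norm (w^b) = 1" using that by (simp_all add: norm_power)
    then have nz: "w^a * w^b \<noteq> 0" by (metis norm_zero mult_eq_0_iff zero_neq_one)
    have "ipoly P w = w^a * w^b * (of_real ((2 * Re (w^a) - 1) * (2 * Re (w^b) - 1)) - 1)"
      unfolding P_eval unit_complex_quadratic[OF n(1)] unit_complex_quadratic[OF n(2)]
      by (simp add: algebra_simps)
    also have "\<dots> = 0 \<longleftrightarrow> (2 * Re (w^a) - 1) * (2 * Re (w^b) - 1) = 1"
      using nz by (metis eq_iff_diff_eq_0 mult_eq_0_iff of_real_1 of_real_eq_iff)
    finally show ?thesis .
  qed
  have nz: "norm z = 1" by (simp add: z_def)
  have "ipoly P z = 0" using P_iff[OF nz] eq ab by simp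
  then have "ipoly P (z ^ k) = 0" by (rule root_of_unity_conjugate[OF zm m k])
  moreover have "norm (z ^ k) = 1" using nz by (simp add: norm_power)
  ultimately show ?thesis using P_iff[of "z ^ k"] by (simp add: ab mult.commute flip: power_mult)
qed

text \<open>Units modulo n lift to units modulo m. This is what allows a conjugation chosen for the
  order n of one root to act on all m-th roots of unity.\<close>

lemma coprime_cong_lift:
  fixes c m n :: nat
  assumes m: "m > 0" and "n dvd m" and c: "coprime c n"
  obtains k where "k > 0" "coprime k m" "[k = c] (mod n)"
proof -
  \<comment> \<open>With this choice each prime q dividing m divides exactly one of c and n t: if q
    divides c, it divides neither n nor t; otherwise it divides t. Hence q does not divide c + n
    t.\<close>
  define t where "t = \<Prod>{q. prime q \<and> q dvd m \<and> \<not> q dvd c}"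
  define k where "k = c + n * t"
  have fin: "finite {q. prime q \<and> q dvd m \<and> \<not> q dvd c}"
    using m by (intro finite_subset[OF _ finite_divisors_nat[of m]]) auto
  have "\<not> q dvd k" if q: "prime q" "q dvd m" for q
  proof (cases "q dvd c")
    case True
    then have "\<not> q dvd n" using c q by (meson coprime_common_divisor not_prime_unit)
    moreover have "\<not> q dvd t"
    proof
      assume "q dvd t"
      then obtain r where "prime r" "\<not> r dvd c" "q dvd r"
        using q fin unfolding t_def by (subst (asm) prime_dvd_prod_iff) auto
      with q True show False using primes_dvd_imp_eq by blast
    qed
    ultimately show ?thesis using True q by (simp add: k_def prime_dvd_mult_iff dvd_add_right_iff)
  next
    case False
    then have "q dvd t" unfolding t_def using q fin by (intro dvd_prodI) auto
    then show ?thesis using False by (simp add: k_def dvd_add_left_iff)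
  qed
  then have "coprime k m"
    unfolding coprime_iff_gcd_eq_1 using prime_factor_nat[of "gcd k m"] by auto
  moreover have "[k = c] (mod n)" by (simp add: k_def cong_def)
  moreover have "k > 0"
  proof (rule ccontr)
    assume "\<not> k > 0"
    then have "c = 0" "n * t = 0" by (auto simp: k_def)
    moreover have "t > 0" unfolding t_def by (intro prod_pos) (auto simp: prime_gt_0_nat)
    moreover have "n > 0" using m assms(2) by (auto intro: Nat.gr0I)
    ultimately show False by simp
  qed
  ultimately show thesis using that by blast
qed

text \<open>Write u = e(a'/n) in lowest terms, where e(x) = exp (2 pi i x). An inverse of a' modulo
  n, lifted to some k coprime to m, gives a' k = 1 + n t, so u^k = e(1/n) up to full turns.\<close>

lemma root_of_unity_conjugate_to_cis:
  fixes u :: complex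
  assumes um: "u ^ m = 1" and m: "m > 0" and u1: "u \<noteq> 1"
  obtains k n where "k > 0" "coprime k m" "n dvd m" "n > 1" "u ^ n = 1" "u ^ k = cis (2 * pi / n)"
proof -
  obtain a where a: "a < m" "u = cis (2 * pi / m) ^ a" using root_of_unity_cis[OF um m] .
  have a0: "a > 0" using a u1 by (intro Nat.gr0I) auto
  define g where "g = gcd a m"
  have g0: "g > 0" using a0 by (simp add: g_def)
  obtain a' n where an: "a = a' * g" "m = n * g" "coprime a' n"
    using gcd_coprime_exists[of a m] g0 unfolding g_def by auto
  have n1: "n > 1"
  proof -
    have "n \<noteq> 0" using an m by auto
    moreover have "\<not> m dvd a" using nat_dvd_not_less a a0 by blast
    then have "n \<noteq> 1" using an by auto
    ultimately show ?thesis by simp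
  qed
  obtain c where c: "[a' * c = 1] (mod n)" using cong_solve_coprime_nat[OF an(3)] by auto
  then have "coprime c n"
    by (auto simp: coprime_iff_invertible_nat mult.commute)
  then obtain k where k: "k > 0" "coprime k m" "[k = c] (mod n)"
    using coprime_cong_lift[OF m, of n c] an by auto
  have "[a' * k = 1] (mod n)" using c k(3) by (metis cong_scalar_left cong_trans)
  then have "a' * k mod n = 1" using n1 by (simp add: cong_def)
  then obtain t where t: "a' * k = 1 + n * t" by (metis mod_mult_div_eq)
  have u: "u = cis (2 * pi * a' / n)" using a an g0 by (simp add: DeMoivre field_simps)
  have "u ^ n = cis (2 * pi * a')" using n1 by (simp add: u DeMoivre)
  then have "u ^ n = 1" by (simp add: cis_multiple_2pi)
  moreover have "u ^ k = cis (2 * pi / n)"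
  proof -
    have "u ^ k = cis (2 * pi * real (a' * k) / n)" by (simp add: u DeMoivre mult_ac)
    also have "2 * pi * real (a' * k) / n = 2 * pi / n + 2 * pi * t"
      using n1 by (simp add: t field_simps)
    also have "cis \<dots> = cis (2 * pi / n)" by (simp flip: cis_mult)
    finally show ?thesis .
  qed
  ultimately show thesis using that k n1 an by (metis dvd_triv_left)
qed

text \<open>For p = 2x - 1 and q = 2y - 1 one has -3 <= q <= 1. From p q = 1, a positive p is at
  least 1 and a negative p is at most -1/3.\<close>

lemma half_units_bound:
  fixes x y :: real
  assumes "(2 * x - 1) * (2 * y - 1) = 1" "x \<le> 1" "\<bar>y\<bar> \<le> 1"
  shows "x = 1 \<or> x \<le> 1 / 3"
proof (rule ccontr)
  assume *: "\<not> ?thesis"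
  define p q where "p = 2 * x - 1" and "q = 2 * y - 1"
  have pq: "p * q = 1" using assms by (simp add: p_def q_def)
  have p: "p > -1/3" "p < 1" and q: "q \<le> 1" "q \<ge> -3" using * assms by (auto simp: p_def q_def)
  show False
  proof (cases "p > 0")
    case True
    then have "p * q \<le> p * 1" using q by (intro mult_left_mono) auto
    then show False using pq p by simp
  next
    case False
    then have "(- p) * (- q) \<le> (- p) * 3" using q by (intro mult_left_mono) auto
    then show False using pq p by simp
  qed
qed

lemma Re_neg_of_small_order:
  fixes u :: complex
  assumes "u \<noteq> 1" "u ^ n = 1" "n = 2 \<or> n = 3"
  shows "Re u < 0"
  using assms(3)
proof
  assume "n = 2"
  then have "u = -1" using assms by (simp add: power2_eq_1_iff)
  then show ?thesis by simp
next
  assume "n = 3"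
  have "(u - 1) * (u ^ 2 + u + 1) = u ^ 3 - 1" by (simp add: power2_eq_square power3_eq_cube algebra_simps)
  then have q: "u ^ 2 + u + 1 = 0" using assms \<open>n = 3\<close> by simp
  have "norm u = 1" using roots_of_unity_norm_1[of u 3] assms \<open>n = 3\<close> by simp
  \<comment> \<open>A primitive cube root of unity has u^2 - u + 1 = -2 u, whence 2 Re u - 1 =
    -2.\<close>
  then have "u * of_real (2 * Re u - 1) = (u ^ 2 + u + 1) - 2 * u"
    by (subst unit_complex_quadratic[symmetric]) auto
  then have "u * of_real (2 * Re u - 1) = u * (- 2)" using q by simp
  moreover have "u \<noteq> 0" using \<open>norm u = 1\<close> by auto
  ultimately have "complex_of_real (2 * Re u - 1) = - 2" by (metis mult_left_cancel)
  then have "complex_of_real (2 * Re u - 1) = complex_of_real (- 2)" by simp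
  then show ?thesis unfolding of_real_eq_iff by simp
qed

lemma Re_neg_of_half_units:
  fixes u v :: complex
  assumes uv: "u ^ m = 1" "v ^ m = 1" and m: "m > 0"
    and eq: "(2 * Re u - 1) * (2 * Re v - 1) = 1"
    and m45: "\<not> 4 dvd m" "\<not> 5 dvd m" and u1: "u \<noteq> 1"
  shows "Re u < 0"
proof -
  obtain k n where k: "k > 0" "coprime k m" and n: "n dvd m" "n > 1" "u ^ n = 1"
    and uk: "u ^ k = cis (2 * pi / n)"
    using root_of_unity_conjugate_to_cis[OF uv(1) m u1] .
  have eqk: "(2 * Re (u ^ k) - 1) * (2 * Re (v ^ k) - 1) = 1"
    by (rule conjugate_Re_equation[OF uv m k(2,1) eq])
  have "norm (v ^ k) = 1" using roots_of_unity_norm_1[OF uv(2) m] by (simp add: norm_power)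
  then have vk: "\<bar>Re (v ^ k)\<bar> \<le> 1" by (metis abs_Re_le_cmod)
  \<comment> \<open>For n >= 6 the value cos (2 pi / n) lies in [1/2, 1), inside the gap left by
    \<open>half_units_bound\<close>.\<close>
  have "n < 6"
  proof (rule ccontr)
    assume "\<not> n < 6"
    then have bounds: "0 < 2 * pi / n" "2 * pi / n \<le> pi / 3" by (auto simp: field_simps)
    then have "cos (2 * pi / n) < cos 0" by (intro cos_monotone_0_pi) auto
    moreover have "cos (pi / 3) \<le> cos (2 * pi / n)" using bounds by (intro cos_monotone_0_pi_le) auto
    ultimately show False using half_units_bound[OF eqk _ vk] by (auto simp: uk cos_60)
  qed
  then have "n \<in> {2, 3, 4, 5}" using n(2) by auto
  then have "n = 2 \<or> n = 3" using n(1) m45 by auto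
  then show ?thesis using Re_neg_of_small_order u1 n(3) by blast
qed

lemma half_units_trivial:
  fixes u v :: complex
  assumes uv: "u ^ m = 1" "v ^ m = 1" and m: "m > 0"
    and eq: "(2 * Re u - 1) * (2 * Re v - 1) = 1"
    and m45: "\<not> 4 dvd m" "\<not> 5 dvd m"
  shows "u = 1"
proof (rule ccontr)
  assume u1: "u \<noteq> 1"
  have u: "Re u < 0" by (rule Re_neg_of_half_units[OF uv m eq m45 u1])
  \<comment> \<open>With v = 1 the equation would force Re u = 1.\<close>
  then have "v \<noteq> 1" using eq by auto
  then have v: "Re v < 0"
    using Re_neg_of_half_units[OF uv(2,1) m _ m45] eq by (simp add: mult.commute)
  have "(1 - 2 * Re u) * (1 - 2 * Re v) > 1"
    using u v by (intro less_1_mult) auto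
  with eq show False by (simp add: algebra_simps)
qed

section \<open>Eigenfunctions and the Fourier transform\<close>

lemma sum_mod_shift:
  fixes f :: "nat \<Rightarrow> 'a :: comm_monoid_add"
  shows "(\<Sum>j<m. f ((j + c) mod m)) = (\<Sum>j<m. f j)"
proof (cases "m = 0")
  case False
  have "inj_on (\<lambda>j. (j + c) mod m) {..<m}"
  proof (rule inj_onI)
    fix x y assume xy: "x \<in> {..<m}" "y \<in> {..<m}" "(x + c) mod m = (y + c) mod m"
    then have "[x + c = y + c] (mod m)" by (simp add: cong_def)
    then have "[x = y] (mod m)" by (simp add: cong_add_rcancel_nat)
    then show "x = y" using xy by (simp add: cong_def)
  qed
  moreover have "(\<lambda>j. (j + c) mod m) ` {..<m} \<subseteq> {..<m}" using False by auto
  ultimately have "bij_betw (\<lambda>j. (j + c) mod m) {..<m} {..<m}"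
    by (simp add: bij_betw_def endo_inj_surj)
  then show ?thesis by (rule sum.reindex_bij_betw)
qed simp

lemma root_of_unity_power_mod:
  fixes w :: "'a :: monoid_mult"
  assumes "w ^ m = 1"
  shows "w ^ (n mod m) = w ^ n"
proof -
  have "w ^ n = w ^ (m * (n div m) + n mod m)" by simp
  also have "\<dots> = w ^ (n mod m)" unfolding power_add power_mult assms by simp
  finally show ?thesis ..
qed

text \<open>Shifting the index by one multiplies the transform by w or by its inverse, the conjugate
  of w; these add up to 2 Re w. The predecessor of j is written \<open>(j + m - 1) mod m\<close> so
  that subtraction on naturals does not truncate at j = 0.\<close>

lemma fourier_neighbours:
  fixes w :: complex
  assumes w: "w ^ m = 1" and m: "m > 0"
  shows "(\<Sum>j<m. (f (Suc j mod m) + f ((j + m - 1) mod m)) * w ^ j)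
    = of_real (2 * Re w) * (\<Sum>j<m. f j * w ^ j)"
proof -
  define g where "g = (\<lambda>k. f k * w ^ k)"
  have n: "w * cnj w = 1" using roots_of_unity_norm_1[OF w m] by (simp add: complex_norm_square[symmetric])
  have g: "g (k mod m) = f (k mod m) * w ^ k" for k
    by (simp add: g_def root_of_unity_power_mod[OF w])
  have "f (Suc j mod m) * w ^ j = cnj w * g ((j + 1) mod m)" for j
    using n by (simp add: g mult.left_commute[of "cnj w"] mult_ac flip: mult.assoc)
  moreover have "f ((j + m - 1) mod m) * w ^ j = w * g ((j + (m - 1)) mod m)" for j
  proof -
    have "w ^ j = w ^ (j + m)" by (simp add: power_add w)
    also have "\<dots> = w * w ^ (j + (m - 1))" using m by (simp flip: power_Suc)
    finally show ?thesis using m by (simp add: g)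
  qed
  ultimately have "(\<Sum>j<m. (f (Suc j mod m) + f ((j + m - 1) mod m)) * w ^ j)
      = (\<Sum>j<m. cnj w * g ((j + 1) mod m) + w * g ((j + (m - 1)) mod m))"
    by (intro sum.cong) (auto simp: distrib_right)
  also have "\<dots> = (cnj w + w) * (\<Sum>j<m. g j)"
    unfolding sum.distrib sum_distrib_left[symmetric] sum_mod_shift distrib_right ..
  also have "cnj w + w = of_real (2 * Re w)" by (simp add: complex_add_cnj add.commute)
  finally show ?thesis by (simp add: g_def)
qed

text \<open>The transform lists the values of the polynomial with coefficients \<open>f i\<close>,
  of degree below m, at the m roots of unity. With m zeros it must be the zero polynomial.\<close>

lemma fourier_inj:
  fixes f :: "nat \<Rightarrow> complex"
  assumes "\<And>w. w ^ m = 1 \<Longrightarrow> (\<Sum>i<m. f i * w ^ i) = 0" and i: "i < m"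
  shows "f i = 0"
proof -
  define p where "p = (\<Sum>i<m. monom (f i) i)"
  have coeff: "coeff p k = (if k < m then f k else 0)" for k
    by (simp add: p_def coeff_sum)
  have "p = 0"
  proof (rule ccontr)
    assume p: "p \<noteq> 0"
    have "{w. w ^ m = 1} \<subseteq> {w. poly p w = 0}"
      using assms(1) by (auto simp: p_def poly_sum poly_monom)
    then have "card {w :: complex. w ^ m = 1} \<le> card {w. poly p w = 0}"
      by (rule card_mono[OF poly_roots_finite[OF p]])
    moreover have "card {w :: complex. w ^ m = 1} = m" using i by (intro card_roots_unity_eq) auto
    ultimately have "m \<le> card {w. poly p w = 0}" by simp
    also have "\<dots> \<le> degree p" using p by (rule card_poly_roots_bound)
    also have "\<dots> < m" using i coeff by (intro degree_lessI) auto
    finally show False by simp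
  qed
  then show ?thesis using coeff[of i] i by simp
qed

lemma fourier_inj2:
  fixes f :: "nat \<Rightarrow> nat \<Rightarrow> complex"
  assumes "\<And>z w. z ^ m = 1 \<Longrightarrow> w ^ m = 1 \<Longrightarrow> (\<Sum>i<m. (\<Sum>j<m. f i j * w ^ j) * z ^ i) = 0"
    and "i < m" "j < m"
  shows "f i j = 0"
proof -
  have "(\<Sum>j<m. f i j * w ^ j) = 0" if "w ^ m = 1" for w
    using fourier_inj[of m "\<lambda>i. \<Sum>j<m. f i j * w ^ j"] assms that by blast
  then show ?thesis using fourier_inj assms(3) by blast
qed

section \<open>Eigenfunctions for the eigenvalue 1 and their uniqueness\<close>

definition one_eigenfunction :: "nat \<Rightarrow> (bool \<times> nat \<times> nat \<Rightarrow> real) \<Rightarrow> bool" where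
  "one_eigenfunction m F \<longleftrightarrow> (\<forall>s. \<forall>i<m. \<forall>j<m.
     F (s, i, Suc j mod m) + F (s, i, (j + m - 1) mod m) + F (\<not> s, j, i) = F (s, i, j))"

lemma one_eigenfunctionD:
  assumes "one_eigenfunction m F" "i < m" "j < m"
  shows "F (s, i, Suc j mod m) + F (s, i, (j + m - 1) mod m) + F (\<not> s, j, i) = F (s, i, j)"
  using assms unfolding one_eigenfunction_def by blast

text \<open>The two transformed equations multiply each Fourier coefficient of \<open>a\<close> by
  (2 Re z - 1) (2 Re w - 1), so it vanishes unless this factor is 1. That leaves only z = w = 1,
  whose coefficient is the sum assumed to be 0.\<close>

lemma one_eigenfunction_sum_0:
  assumes F: "one_eigenfunction m F" and m: "m > 0" and m45: "\<not> 4 dvd m" "\<not> 5 dvd m"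
    and sum0: "(\<Sum>i<m. \<Sum>j<m. F (True, i, j)) = 0" and ij: "i < m" "j < m"
  shows "F (s, i, j) = 0"
proof -
  \<comment> \<open>Transposing the indices in \<open>c\<close> makes the edge between the two
    halves join equal index pairs; the cycles of the x^- half then run along the first
    index.\<close>
  define a c where "a = (\<lambda>i j. complex_of_real (F (True, i, j)))"
    and "c = (\<lambda>i j. complex_of_real (F (False, j, i)))"
  have c: "c i j = a i j - (a i (Suc j mod m) + a i ((j + m - 1) mod m))" if "i < m" "j < m" for i j
  proof -
    have "F (False, j, i) = F (True, i, j) - (F (True, i, Suc j mod m) + F (True, i, (j + m - 1) mod m))"
      using one_eigenfunctionD[OF F that, of True] by simp
    then show ?thesis unfolding a_def c_def by simp
  qed
  have a: "a i j = c i j - (c (Suc i mod m) j + c ((i + m - 1) mod m) j)" if "i < m" "j < m" for i j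
  proof -
    have "F (True, i, j) = F (False, j, i) - (F (False, j, Suc i mod m) + F (False, j, (i + m - 1) mod m))"
      using one_eigenfunctionD[OF F that(2,1), of False] by simp
    then show ?thesis unfolding a_def c_def by simp
  qed
  have a0: "a i j = 0" if "i < m" "j < m" for i j
  proof (rule fourier_inj2[where f = a, OF _ that])
    fix z w :: complex assume zw: "z ^ m = 1" "w ^ m = 1"
    let ?S = "\<lambda>f. \<Sum>i<m. (\<Sum>j<m. f i j * w ^ j) * z ^ i"
    have "?S c = (\<Sum>i<m. ((\<Sum>j<m. a i j * w ^ j)
        - (\<Sum>j<m. (a i (Suc j mod m) + a i ((j + m - 1) mod m)) * w ^ j)) * z ^ i)"
      by (intro sum.cong refl arg_cong2[of _ _ _ _ "(*)"])
        (auto simp: c left_diff_distrib simp flip: sum_subtractf)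
    also have "\<dots> = of_real (1 - 2 * Re w) * ?S a"
      unfolding fourier_neighbours[OF zw(2) m]
      by (simp add: sum_distrib_left algebra_simps sum_subtractf)
    finally have Sc: "?S c = of_real (1 - 2 * Re w) * ?S a" .
    \<comment> \<open>Brings the transform in the first index inside, where the shifts in the
      equation for \<open>a\<close> act.\<close>
    have swap: "?S f = (\<Sum>j<m. (\<Sum>i<m. f i j * z ^ i) * w ^ j)" for f
      unfolding sum_distrib_right by (subst sum.swap) (simp add: mult_ac)
    have "?S a = (\<Sum>j<m. ((\<Sum>i<m. c i j * z ^ i)
        - (\<Sum>i<m. (c (Suc i mod m) j + c ((i + m - 1) mod m) j) * z ^ i)) * w ^ j)"
      unfolding swap by (intro sum.cong refl arg_cong2[of _ _ _ _ "(*)"])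
        (auto simp: a left_diff_distrib simp flip: sum_subtractf)
    also have "\<dots> = (\<Sum>j<m. ((\<Sum>i<m. c i j * z ^ i)
        - of_real (2 * Re z) * (\<Sum>i<m. c i j * z ^ i)) * w ^ j)"
      by (subst fourier_neighbours[OF zw(1) m]) (rule refl)
    also have "\<dots> = of_real (1 - 2 * Re z) * ?S c"
      unfolding swap by (simp add: sum_distrib_left algebra_simps sum_subtractf)
    finally have "?S a = of_real ((2 * Re z - 1) * (2 * Re w - 1)) * ?S a"
      unfolding Sc by (simp add: algebra_simps)
    then have "?S a = 0 \<or> complex_of_real ((2 * Re z - 1) * (2 * Re w - 1)) = 1"
      by (rule iffD1[OF mult_cancel_right1])
    then consider "?S a = 0" | "(2 * Re z - 1) * (2 * Re w - 1) = 1"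
      unfolding of_real_eq_1_iff by blast
    then show "?S a = 0"
    proof cases
      case 2
      then have "z = 1" "w = 1"
        using half_units_trivial[OF zw m _ m45] half_units_trivial[OF zw(2,1) m _ m45]
        by (simp_all add: mult.commute)
      then have "?S a = of_real (\<Sum>i<m. \<Sum>j<m. F (True, i, j))" by (simp add: a_def)
      then show ?thesis using sum0 by simp
    qed
  qed
  have "c i j = 0" if "i < m" "j < m" for i j
    using c[OF that] a0 that m by simp
  then show ?thesis using a0[OF ij] ij by (cases s) (auto simp: a_def c_def)
qed

lemma one_eigenfunction_unique:
  assumes F: "one_eigenfunction m F" and m: "m > 0" and m45: "\<not> 4 dvd m" "\<not> 5 dvd m"
  shows "\<exists>\<mu>. \<forall>s. \<forall>i<m. \<forall>j<m. F (s, i, j) = (if s then \<mu> else - \<mu>)"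
proof -
  \<comment> \<open>The mean of F over the m^2 vertices x^+. Subtracting this multiple of the
    eigenfunction with values 1 and -1 makes the sum over x^+ vanish.\<close>
  define \<mu> where "\<mu> = (\<Sum>i<m. \<Sum>j<m. F (True, i, j)) / m ^ 2"
  define G where "G = (\<lambda>(s, i, j). F (s, i, j) - (if s then \<mu> else - \<mu>))"
  have G: "one_eigenfunction m G"
    unfolding one_eigenfunction_def
  proof (intro allI impI)
    fix s i j assume "i < m" "j < m"
    then show "G (s, i, Suc j mod m) + G (s, i, (j + m - 1) mod m) + G (\<not> s, j, i) = G (s, i, j)"
      using one_eigenfunctionD[OF F, of i j s] by (cases s) (simp_all add: G_def)
  qed
  have "(\<Sum>i<m. \<Sum>j<m. G (True, i, j)) = 0"
    using m by (simp add: G_def sum_subtractf \<mu>_def power2_eq_square)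
  from one_eigenfunction_sum_0[OF G m m45 this] show ?thesis
    by (intro exI[of _ \<mu>]) (auto simp: G_def)
qed

section \<open>Further eigenfunctions when 4 or 5 divides m\<close>

lemma cos_mod_neighbours:
  fixes m a :: nat
  assumes m: "m > 0"
  defines "\<theta> \<equiv> 2 * pi * a / m"
  shows "cos (real (Suc j mod m) * \<theta>) + cos (real ((j + m - 1) mod m) * \<theta>)
    = 2 * cos \<theta> * cos (j * \<theta>)"
proof -
  \<comment> \<open>Since m theta is a multiple of 2 pi, reducing the index modulo m does not change
    the cosine.\<close>
  have per: "cos (real (n mod m) * \<theta>) = cos (real n * \<theta>)" for n
  proof -
    have "real n * \<theta> = real (n mod m) * \<theta> + 2 * pi * real (a * (n div m))"
    proof -
      have n: "real n = real (n mod m) + real m * real (n div m)"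
        by (metis mod_mult_div_eq of_nat_add of_nat_mult)
      have "real n * \<theta> = real (n mod m) * \<theta> + real m * \<theta> * real (n div m)"
        by (subst n) (simp only: algebra_simps)
      then show ?thesis using m by (simp add: \<theta>_def mult_ac)
    qed
    then show ?thesis by (simp add: cos_add cos_int_2pin[of "int (a * (n div m))", simplified] sin_int_2pin[of "int (a * (n div m))", simplified])
  qed
  have "real (j + m - 1) * \<theta> = (real j * \<theta> - \<theta>) + 2 * pi * a"
    using m by (simp add: \<theta>_def field_simps of_nat_diff)
  then have "cos (real (j + m - 1) * \<theta>) = cos (real j * \<theta> - \<theta>)"
    by (simp add: cos_add cos_int_2pin[of "int a", simplified] sin_int_2pin[of "int a", simplified])
  moreover have "real (Suc j) * \<theta> = real j * \<theta> + \<theta>" by (simp add: algebra_simps)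
  ultimately show ?thesis unfolding per by (simp add: cos_add cos_diff)
qed

text \<open>Summing cos (j beta) over the two cycle neighbours multiplies it by 2 cos beta. The
  equation at x^+ therefore dictates the factor 1 - 2 cos beta on x^-, and the equation at x^- then
  amounts to \<open>eq\<close>.\<close>

lemma one_eigenfunction_cos:
  fixes m a b :: nat
  defines "\<alpha> \<equiv> 2 * pi * a / m" and "\<beta> \<equiv> 2 * pi * b / m"
  assumes m: "m > 0" and eq: "(1 - 2 * cos \<alpha>) * (1 - 2 * cos \<beta>) = 1"
  shows "one_eigenfunction m (\<lambda>(s, i, j). if s then cos (real i * \<alpha>) * cos (real j * \<beta>)
    else (1 - 2 * cos \<beta>) * (cos (real j * \<alpha>) * cos (real i * \<beta>)))"
  unfolding one_eigenfunction_def
proof (intro allI impI)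
  fix s :: bool and i j assume "i < m" "j < m"
  have A: "cos (real (Suc j mod m) * \<alpha>) = 2 * cos \<alpha> * cos (j * \<alpha>) - cos (real ((j + m - 1) mod m) * \<alpha>)"
    using cos_mod_neighbours[OF m, of j a] unfolding \<alpha>_def by simp
  have B: "cos (real (Suc j mod m) * \<beta>) = 2 * cos \<beta> * cos (j * \<beta>) - cos (real ((j + m - 1) mod m) * \<beta>)"
    using cos_mod_neighbours[OF m, of j b] unfolding \<beta>_def by simp
  let ?F = "\<lambda>(s, i, j). if s then cos (real i * \<alpha>) * cos (real j * \<beta>)
    else (1 - 2 * cos \<beta>) * (cos (real j * \<alpha>) * cos (real i * \<beta>))"
  show "?F (s, i, Suc j mod m) + ?F (s, i, (j + m - 1) mod m) + ?F (\<not> s, j, i) = ?F (s, i, j)"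
  proof (cases s)
    case True
    then show ?thesis unfolding prod.case by (simp only: B) (simp add: algebra_simps)
  next
    case False
    have "cos (real j * \<alpha>) * cos (real i * \<beta>) = ((1 - 2 * cos \<alpha>) * (1 - 2 * cos \<beta>)) * (cos (real j * \<alpha>) * cos (real i * \<beta>))"
      by (simp add: eq)
    then show ?thesis using False unfolding prod.case by (simp only: A) (simp add: algebra_simps)
  qed
qed

text \<open>The angle t = 2 pi / 5 satisfies cos 3t = cos 2t. Removing the root x = 1 from this
  cubic in x = cos t leaves 4 x^2 + 2 x - 1 = 0, which reduces the product to 1.\<close>

lemma cos_fifth_eq: "(1 - 2 * cos (2 * pi / 5)) * (1 - 2 * cos (4 * pi / 5)) = 1"
proof -
  define x where "x = cos (2 * pi / 5)"
  have d: "cos (4 * pi / 5) = 2 * x ^ 2 - 1"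
    using cos_double_cos[of "2 * pi / 5"] by (simp add: x_def)
  have "3 * (2 * pi / 5) = 2 * pi - 4 * pi / 5" by simp
  then have "cos (3 * (2 * pi / 5)) = cos (2 * pi - 4 * pi / 5)" by (simp only:)
  also have "\<dots> = cos (4 * pi / 5)" by (rule cos_2pi_minus)
  finally have "4 * x ^ 3 - 3 * x = 2 * x ^ 2 - 1" unfolding cos_treble_cos d x_def .
  then have "(x - 1) * (4 * x ^ 2 + 2 * x - 1) = 0" by (simp add: algebra_simps power3_eq_cube power2_eq_square)
  moreover have "x < cos 0" unfolding x_def by (intro cos_monotone_0_pi) auto
  ultimately have q: "4 * x ^ 2 = 1 - 2 * x" by simp
  have "4 * x ^ 3 = x * (4 * x ^ 2)" by (simp add: power3_eq_cube power2_eq_square)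
  also have "\<dots> = x - 2 * x ^ 2" unfolding q by (simp add: power2_eq_square algebra_simps)
  finally have "4 * x ^ 3 = x - 2 * x ^ 2" .
  then show ?thesis unfolding d x_def[symmetric] using q
    by (simp add: algebra_simps power3_eq_cube power2_eq_square)
qed

text \<open>The second conjunct ensures that the resulting eigenfunction is not constant on the x^+
  vertices.\<close>

lemma exists_half_units:
  fixes m :: nat
  assumes m: "m > 0" and "4 dvd m \<or> 5 dvd m"
  shows "\<exists>(a :: nat) (b :: nat). (1 - 2 * cos (2 * pi * a / m)) * (1 - 2 * cos (2 * pi * b / m)) = 1
    \<and> cos (2 * pi * a / m) \<noteq> 1"
  using assms(2)
proof
  assume "4 dvd m"
  then obtain t where t: "m = 4 * t" by blast
  then have "2 * pi * t / m = pi / 2" using m by simp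
  \<comment> \<open>Both a and b are m/4, so both cosines vanish.\<close>
  then show ?thesis by (intro exI[of _ t]) (simp only: cos_pi_half, simp)
next
  assume "5 dvd m"
  then obtain t where t: "m = 5 * t" by blast
  then have "2 * pi * t / m = 2 * pi / 5" "2 * pi * real (2 * t) / m = 4 * pi / 5" using m by simp_all
  moreover have "cos (2 * pi / 5) < cos 0" by (intro cos_monotone_0_pi) auto
  ultimately show ?thesis using cos_fifth_eq by (intro exI[of _ t] exI[of _ "2 * t"]) (simp only: cos_zero, simp)
qed

section \<open>The eigenspace of the adjacency matrix\<close>

text \<open>Replaces bases and dimension by a single generating vector, so that only scalar
  multiples occur afterwards. Both directions rest on the span of one vector being its set of
  multiples.\<close>

lemma kernel_dim_eq_1_iff:
  fixes A :: "'a :: field mat"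
  assumes A: "A \<in> carrier_mat nr nc"
  shows "kernel_dim A = 1 \<longleftrightarrow>
    (\<exists>v\<in>mat_kernel A. v \<noteq> 0\<^sub>v nc \<and> (\<forall>w\<in>mat_kernel A. \<exists>c. w = c \<cdot>\<^sub>v v))"
proof -
  interpret K: kernel nr nc A by standard (rule A)
  have lincomb_single: "K.Ker.lincomb c {v} = c v \<cdot>\<^sub>v v" if v: "v \<in> mat_kernel A" for c v
  proof -
    have "dim_vec v = nc" using mat_kernel_carrier[OF A] v by auto
    moreover have "K.Ker.lincomb c {v} \<in> mat_kernel A" using v by (intro K.Ker.lincomb_closed) auto
    then have "dim_vec (K.Ker.lincomb c {v}) = nc" using mat_kernel_carrier[OF A] by auto
    ultimately show ?thesis using v by (intro eq_vecI) (auto simp: K.lincomb_index)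
  qed
  have span_single: "K.Ker.span {v} = {c \<cdot>\<^sub>v v | c. True}" if v: "v \<in> mat_kernel A" for v
  proof -
    have "c \<cdot>\<^sub>v v \<in> K.Ker.span {v}" for c
    proof -
      have "K.Ker.lincomb (\<lambda>_. c) {v} \<in> K.Ker.span {v}"
        unfolding K.Ker.span_def by blast
      then show ?thesis by (simp add: lincomb_single[OF v])
    qed
    moreover have "\<exists>c. w = c \<cdot>\<^sub>v v" if "w \<in> K.Ker.span {v}" for w
    proof -
      have "\<exists>c. w = K.Ker.lincomb c {v}"
        using K.Ker.finite_span[of "{v}"] that v by auto
      then show ?thesis using lincomb_single[OF v] by blast
    qed
    ultimately show ?thesis by blast
  qed
  show ?thesis
  proof
    assume "kernel_dim A = 1"
    then have dim: "K.dim = 1" by simp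
    obtain B where B: "finite B" "K.basis B" using kernel_basis_exists[OF A] by blast
    then have "card B = 1" using dim K.Ker.dim_basis by simp
    then obtain v where v: "B = {v}" by (auto simp: card_1_singleton_iff)
    have vk: "v \<in> mat_kernel A" and gen: "K.Ker.span {v} = mat_kernel A"
      and indep: "\<not> K.lin_dep {v}"
      using B(2) v by (auto simp: K.Ker.basis_def)
    \<comment> \<open>An independent set excludes the zero vector only over a nontrivial
      ring.\<close>
    have "(1 :: 'a) \<notin> {0}" by simp
    then have "(UNIV :: 'a set) \<noteq> {0}" by (metis UNIV_I)
    then have "v \<noteq> 0\<^sub>v nc" using indep K.Ker.zero_nin_lin_indpt[of "{v}"] vk by auto
    then show "\<exists>v\<in>mat_kernel A. v \<noteq> 0\<^sub>v nc \<and> (\<forall>w\<in>mat_kernel A. \<exists>c. w = c \<cdot>\<^sub>v v)"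
      using vk gen span_single[OF vk] by blast
  next
    assume "\<exists>v\<in>mat_kernel A. v \<noteq> 0\<^sub>v nc \<and> (\<forall>w\<in>mat_kernel A. \<exists>c. w = c \<cdot>\<^sub>v v)"
    then obtain v where v: "v \<in> mat_kernel A" "v \<noteq> 0\<^sub>v nc" "\<forall>w\<in>mat_kernel A. \<exists>c. w = c \<cdot>\<^sub>v v"
      by blast
    have "K.Ker.span {v} \<subseteq> mat_kernel A" using v by (intro K.Ker.span_is_subset2) auto
    then have "K.Ker.span {v} = mat_kernel A" using v span_single[OF v(1)] by blast
    then show "kernel_dim A = 1" using K.Ker.dim1I[of v] v by simp
  qed
qed

lemma bij_betw_T_vertex:
  assumes m: "m > 0"
  shows "bij_betw (T_vertex m) {..<2 * m^2} (UNIV \<times> {..<m} \<times> {..<m})"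
proof (rule bij_betwI[where g = "\<lambda>(s, i, j). (if s then 0 else m^2) + (i * m + j)"])
  show "T_vertex m \<in> {..<2 * m^2} \<rightarrow> UNIV \<times> {..<m} \<times> {..<m}"
  proof (rule funcsetI)
    fix n assume "n \<in> {..<2 * m^2}"
    have "n mod m^2 < m * m" using m by (simp add: power2_eq_square)
    then have "(n mod m^2) div m < m" by (simp add: less_mult_imp_div_less)
    then show "T_vertex m n \<in> UNIV \<times> {..<m} \<times> {..<m}" using m by (simp add: T_vertex_def)
  qed
  have bound: "i * m + j < m^2" if "i < m" "j < m" for i j
  proof -
    have "i * m + j < Suc i * m" using that by simp
    also have "\<dots> \<le> m * m" using that by (intro mult_right_mono) auto
    finally show ?thesis by (simp add: power2_eq_square)
  qed
  show "(\<lambda>(s, i, j). (if s then 0 else m^2) + (i * m + j)) \<in> UNIV \<times> {..<m} \<times> {..<m} \<rightarrow> {..<2 * m^2}"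
    using bound by fastforce
  show "(\<lambda>(s, i, j). (if s then 0 else m^2) + (i * m + j)) (T_vertex m n) = n"
    if "n \<in> {..<2 * m^2}" for n
  proof -
    \<comment> \<open>\<open>T_vertex\<close> reads j from n itself instead of from n mod m^2; the
      two agree because m divides m^2.\<close>
    have "n mod m = (n mod m^2) mod m" by (simp add: mod_mod_cancel power2_eq_square)
    then have "(n mod m^2) div m * m + n mod m = n mod m^2" by (metis div_mult_mod_eq)
    moreover have "(if n < m^2 then 0 else m^2) + n mod m^2 = n"
      using that by (auto simp: mod_if)
    ultimately show ?thesis by (simp add: T_vertex_def)
  qed
  show "T_vertex m ((\<lambda>(s, i, j). (if s then 0 else m^2) + (i * m + j)) x) = x"
    if "x \<in> UNIV \<times> {..<m} \<times> {..<m}" for x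
  proof -
    obtain s i j where x: "x = (s, i, j)" by (cases x)
    then have ij: "i < m" "j < m" using that by auto
    have "(m^2 + (i * m + j)) mod m = j" using ij by (simp add: power2_eq_square)
    then show ?thesis using ij bound[OF ij] by (auto simp: x T_vertex_def)
  qed
qed

lemma T_adj_neighbours:
  assumes m: "m \<ge> 3" and ij: "i < m" "j < m"
  shows "{y \<in> UNIV \<times> {..<m} \<times> {..<m}. T_adj m (s, i, j) y}
    = {(s, i, Suc j mod m), (s, i, (j + m - 1) mod m), (\<not> s, j, i)}"
proof -
  have "j = Suc l mod m \<longleftrightarrow> l = (j + m - 1) mod m" if "l < m" for l
    using that ij by (cases "Suc l = m"; cases j) auto
  then show ?thesis using ij by (auto simp: T_adj_def)
qed

lemma T_adj_sum:
  fixes F :: "bool \<times> nat \<times> nat \<Rightarrow> real"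
  assumes m: "m \<ge> 3" and ij: "i < m" "j < m"
  shows "(\<Sum>y\<in>UNIV \<times> {..<m} \<times> {..<m}. (if T_adj m (s, i, j) y then 1 else 0) * F y)
    = F (s, i, Suc j mod m) + F (s, i, (j + m - 1) mod m) + F (\<not> s, j, i)"
proof -
  \<comment> \<open>Here m >= 3 matters: the two cycle neighbours are different, so the neighbour
    set contributes three separate terms.\<close>
  have "Suc j mod m \<noteq> (j + m - 1) mod m"
    using m ij by (cases "Suc j = m"; cases j) auto
  moreover have "(\<Sum>y\<in>UNIV \<times> {..<m} \<times> {..<m}. (if T_adj m (s, i, j) y then 1 else 0) * F y)
      = (\<Sum>y\<in>{y \<in> UNIV \<times> {..<m} \<times> {..<m}. T_adj m (s, i, j) y}. F y)"
    by (simp add: sum.inter_filter if_distrib[of "\<lambda>x. x * _"] cong: if_cong)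
  ultimately show ?thesis unfolding T_adj_neighbours[OF m ij] by simp
qed

lemma T_adj_matrix_carrier: "T_adj_matrix m \<in> carrier_mat (2 * m^2) (2 * m^2)"
  by (simp add: T_adj_matrix_def)

text \<open>Carries functions on triples to vectors in the numbering of the matrix. Values off the
  vertex set are forgotten, so multiples of eigenfunctions are compared as vectors.\<close>

definition vertex_vec :: "nat \<Rightarrow> (bool \<times> nat \<times> nat \<Rightarrow> real) \<Rightarrow> real vec" where
  "vertex_vec m F = vec (2 * m^2) (\<lambda>n. F (T_vertex m n))"

lemma vertex_vec_carrier: "vertex_vec m F \<in> carrier_vec (2 * m^2)"
  by (simp add: vertex_vec_def)

lemma all_T_vertex_iff:
  assumes "m > 0"
  shows "(\<forall>n<2 * m^2. P (T_vertex m n)) \<longleftrightarrow> (\<forall>s. \<forall>i<m. \<forall>j<m. P (s, i, j))"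
proof -
  have "(\<forall>n<2 * m^2. P (T_vertex m n)) \<longleftrightarrow> (\<forall>x\<in>T_vertex m ` {..<2 * m^2}. P x)" by auto
  also have "T_vertex m ` {..<2 * m^2} = UNIV \<times> {..<m} \<times> {..<m}"
    using bij_betw_T_vertex[OF assms] by (simp add: bij_betw_def)
  finally show ?thesis by auto
qed

lemma vertex_vec_eq_iff:
  assumes "m > 0"
  shows "vertex_vec m F = vertex_vec m G \<longleftrightarrow> (\<forall>s. \<forall>i<m. \<forall>j<m. F (s, i, j) = G (s, i, j))"
proof -
  have "vertex_vec m F = vertex_vec m G \<longleftrightarrow> (\<forall>n<2 * m^2. F (T_vertex m n) = G (T_vertex m n))"
    by (auto simp: vertex_vec_def vec_eq_iff)
  then show ?thesis using all_T_vertex_iff[OF assms, of "\<lambda>x. F x = G x"] by simp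
qed

lemma vertex_vec_surj:
  assumes m: "m > 0" and v: "v \<in> carrier_vec (2 * m^2)"
  obtains F where "v = vertex_vec m F"
proof
  let ?g = "the_inv_into {..<2 * m^2} (T_vertex m)"
  have "inj_on (T_vertex m) {..<2 * m^2}" using bij_betw_T_vertex[OF m] by (simp add: bij_betw_def)
  then show "v = vertex_vec m (\<lambda>x. v $ ?g x)"
    using v by (intro eq_vecI) (auto simp: vertex_vec_def the_inv_into_f_f)
qed

lemma vertex_vec_smult: "c \<cdot>\<^sub>v vertex_vec m F = vertex_vec m (\<lambda>x. c * F x)"
  by (auto simp: vertex_vec_def)

lemma mat_kernel_T_iff:
  assumes m: "m \<ge> 3"
  shows "vertex_vec m F \<in> mat_kernel (char_matrix (T_adj_matrix m) 1) \<longleftrightarrow> one_eigenfunction m F"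
proof -
  let ?A = "T_adj_matrix m" and ?N = "2 * m^2" and ?v = "vertex_vec m F"
  have entry: "(char_matrix ?A 1 *\<^sub>v ?v) $ n
      = (\<Sum>y\<in>UNIV \<times> {..<m} \<times> {..<m}. (if T_adj m (T_vertex m n) y then 1 else 0) * F y) - F (T_vertex m n)"
    if n: "n < ?N" for n
  proof -
    have "(char_matrix ?A 1 *\<^sub>v ?v) $ n = (\<Sum>b<?N. char_matrix ?A 1 $$ (n, b) * F (T_vertex m b))"
      using n T_adj_matrix_carrier[of m]
      by (auto simp: char_matrix_def vertex_vec_def scalar_prod_def atLeast0LessThan intro!: sum.cong)
    \<comment> \<open>The characteristic matrix is the adjacency matrix minus the identity, which
      contributes the term at b = n.\<close>
    also have "\<dots> = (\<Sum>b<?N. (if T_adj m (T_vertex m n) (T_vertex m b) then 1 else 0) * F (T_vertex m b)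
        - (if b = n then F (T_vertex m b) else 0))"
      using n by (intro sum.cong refl) (auto simp: char_matrix_def T_adj_matrix_def algebra_simps)
    also have "\<dots> = (\<Sum>b<?N. (if T_adj m (T_vertex m n) (T_vertex m b) then 1 else 0) * F (T_vertex m b))
        - F (T_vertex m n)"
      using n by (simp add: sum_subtractf)
    also have "(\<Sum>b<?N. (if T_adj m (T_vertex m n) (T_vertex m b) then 1 else 0) * F (T_vertex m b))
        = (\<Sum>y\<in>UNIV \<times> {..<m} \<times> {..<m}. (if T_adj m (T_vertex m n) y then 1 else 0) * F y)"
      using m by (intro sum.reindex_bij_betw[OF bij_betw_T_vertex]) simp
    finally show ?thesis .
  qed
  have "?v \<in> mat_kernel (char_matrix ?A 1) \<longleftrightarrow> char_matrix ?A 1 *\<^sub>v ?v = 0\<^sub>v ?N"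
    using mat_kernel[OF char_matrix_closed[OF T_adj_matrix_carrier]] vertex_vec_carrier by auto
  also have "\<dots> \<longleftrightarrow> (\<forall>n<?N. (char_matrix ?A 1 *\<^sub>v ?v) $ n = 0)"
    using T_adj_matrix_carrier[of m] by (auto simp: vec_eq_iff char_matrix_def)
  also have "\<dots> \<longleftrightarrow> (\<forall>n<?N. (\<Sum>y\<in>UNIV \<times> {..<m} \<times> {..<m}.
      (if T_adj m (T_vertex m n) y then 1 else 0) * F y) - F (T_vertex m n) = 0)"
    by (simp add: entry)
  also have "\<dots> \<longleftrightarrow> one_eigenfunction m F"
    using m by (subst all_T_vertex_iff) (auto simp: one_eigenfunction_def T_adj_sum[OF m])
  finally show ?thesis .
qed

lemma simple_eigenvalue_T_iff:
  assumes m: "m \<ge> 3"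
  shows "simple_eigenvalue (T_adj_matrix m) 1 \<longleftrightarrow>
    (\<exists>F. one_eigenfunction m F \<and> vertex_vec m F \<noteq> vertex_vec m (\<lambda>_. 0) \<and>
      (\<forall>G. one_eigenfunction m G \<longrightarrow> (\<exists>c. vertex_vec m G = c \<cdot>\<^sub>v vertex_vec m F)))"
proof -
  let ?A = "char_matrix (T_adj_matrix m) 1"
  have A: "?A \<in> carrier_mat (2 * m^2) (2 * m^2)" by (rule char_matrix_closed[OF T_adj_matrix_carrier])
  have "mat_kernel ?A = vertex_vec m ` {F. one_eigenfunction m F}"
  proof -
    have "\<exists>F. v = vertex_vec m F" if "v \<in> mat_kernel ?A" for v
      using vertex_vec_surj[of m v] m that mat_kernel_carrier[OF A] by auto
    then show ?thesis using mat_kernel_T_iff[OF m] by auto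
  qed
  moreover have "0\<^sub>v (2 * m^2) = vertex_vec m (\<lambda>_. 0)" by (auto simp: vertex_vec_def)
  ultimately show ?thesis
    unfolding simple_eigenvalue_def kernel_dim_eq_1_iff[OF A] by auto
qed

theorem theorem6p11:
  fixes m :: nat
  assumes "m \<ge> 3"
  shows "simple_eigenvalue (T_adj_matrix m) 1 \<longleftrightarrow> \<not> 4 dvd m \<and> \<not> 5 dvd m"
proof -
  have m: "m > 0" using assms by simp
  \<comment> \<open>The eigenfunction for the pair (1, 1): at each vertex the two cycle neighbours
    contribute twice its value and the third neighbour cancels one of them.\<close>
  define E :: "bool \<times> nat \<times> nat \<Rightarrow> real" where "E = (\<lambda>(s, i, j). if s then 1 else -1)"
  have E: "one_eigenfunction m E" by (simp add: one_eigenfunction_def E_def)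
  show ?thesis
  proof
    assume "simple_eigenvalue (T_adj_matrix m) 1"
    then obtain F where F: "\<And>G. one_eigenfunction m G \<Longrightarrow> \<exists>c. vertex_vec m G = c \<cdot>\<^sub>v vertex_vec m F"
      unfolding simple_eigenvalue_T_iff[OF assms] by blast
    show "\<not> 4 dvd m \<and> \<not> 5 dvd m"
    proof (rule ccontr)
      assume "\<not> ?thesis"
      then obtain a b :: nat where
        eq: "(1 - 2 * cos (2 * pi * a / m)) * (1 - 2 * cos (2 * pi * b / m)) = 1"
        and ne: "cos (2 * pi * a / m) \<noteq> 1"
        using exists_half_units[OF m] by blast
      obtain c where "vertex_vec m E = c \<cdot>\<^sub>v vertex_vec m F" using F[OF E] by blast
      then have c: "E (s, i, j) = c * F (s, i, j)" if "i < m" "j < m" for s i j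
        using that by (simp add: vertex_vec_smult vertex_vec_eq_iff[OF m])
      define G :: "bool \<times> nat \<times> nat \<Rightarrow> real" where
        "G = (\<lambda>(s, i, j). if s then cos (real i * (2 * pi * a / m)) * cos (real j * (2 * pi * b / m))
          else (1 - 2 * cos (2 * pi * b / m))
            * (cos (real j * (2 * pi * a / m)) * cos (real i * (2 * pi * b / m))))"
      obtain d where "vertex_vec m G = d \<cdot>\<^sub>v vertex_vec m F"
        using F[OF one_eigenfunction_cos[OF m eq]] unfolding G_def by blast
      then have d: "G (s, i, j) = d * F (s, i, j)" if "i < m" "j < m" for s i j
        using that by (simp add: vertex_vec_smult vertex_vec_eq_iff[OF m])
      \<comment> \<open>\<open>E\<close> and \<open>G\<close> are multiples of the same F. As
        \<open>E\<close> is constant and nonzero on x^+, F agrees at x^+_{0,0} and x^+_{1,0},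
        whereas \<open>G\<close> takes the values 1 and cos (2 pi a / m) there.\<close>
      have "c * F (True, 0, 0) = c * F (True, 1, 0)" "c \<noteq> 0"
        using c[of 0 0 True] c[of 1 0 True] assms by (auto simp: E_def)
      then have "F (True, 0, 0) = F (True, 1, 0)" by simp
      then show False using d[of 0 0 True] d[of 1 0 True] assms ne by (simp add: G_def)
    qed
  next
    assume m45: "\<not> 4 dvd m \<and> \<not> 5 dvd m"
    have "vertex_vec m E \<noteq> vertex_vec m (\<lambda>_. 0)"
      using m by (auto simp: vertex_vec_eq_iff E_def)
    moreover have "\<exists>c. vertex_vec m G = c \<cdot>\<^sub>v vertex_vec m E" if G: "one_eigenfunction m G" for G
    proof -
      obtain \<mu> where "\<forall>s. \<forall>i<m. \<forall>j<m. G (s, i, j) = (if s then \<mu> else - \<mu>)"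
        using one_eigenfunction_unique[OF G m] m45 by blast
      then show ?thesis
        unfolding vertex_vec_smult vertex_vec_eq_iff[OF m] by (intro exI[of _ \<mu>]) (auto simp: E_def)
    qed
    ultimately show "simple_eigenvalue (T_adj_matrix m) 1"
      unfolding simple_eigenvalue_T_iff[OF assms] using E by blast
  qed
qed

end
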